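(* Let $1\le q\le\alpha\le p\le\infty$. For any $\mu$-measurable function $f$ on $X$ and any $r>0$, one has ${}_{r}\|f\|_{q,p,\alpha}=0$ if and only if $f=0$ $\mu$-almost everywhere.
   Context: Setting. $(X,d,\mu)$ is a space of homogeneous type: $d$ is a quasi-metric on $X$ (with a constant $\kappa\ge 1$ such that $d(x,y)\le\kappa(d(x,z)+d(z,y))$ for all $x,y,z\in X$), and $\mu$ is a non-negative Borel measure such that, with $B(x,r)=\{y\in X: d(x,y)<r\}$, there is a constant $C$ with $0<\mu(B(x,2r))\le C\mu(B(x,r))<\infty$ for all $x\in X$, $r>0$. It is assumed moreover that all balls $B(x,r)$ are open for the $d$-topology, $(X,d)$ is separable, $\mu(X)=\infty$, and $B(x,R)\setminus B(x,r)\neq\emptyset$ for all $x\in X$ and $0<r<R<\infty$. Notation. $\|\cdot\|_q$ is the usual norm of $L^q(X)=L^q(X,\mu)$, and $\chi_E$ is the characteristic function of $E$. For a $\mu$-measurable complex-valued $f$ on $X$ and $r>0$ (convention $1/\infty=0$), $${}_{r}\|f\|_{q,p,\alpha}=\left[\int_X\left(\mu(B(y,r))^{\frac1\alpha-\frac1p-\frac1q}\,\|f\chi_{B(y,r)}\|_q\right)^p d\mu(y)\right]^{1/p}\quad\text{if } p<\infty,$$ $${}_{r}\|f\|_{q,\infty,\alpha}=\sup_{y\in X}\mu(B(y,r))^{\frac1\alpha-\frac1q}\,\|f\chi_{B(y,r)}\|_q\quad\text{if } p=\infty.$$ *)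

theory Defs
  imports "HOL-Analysis.Analysis" "HOL-Probability.Essential_Supremum"
begin

definition qball :: "'a set \<Rightarrow> ('a \<Rightarrow> 'a \<Rightarrow> real) \<Rightarrow> 'a \<Rightarrow> real \<Rightarrow> 'a set" where
  "qball X d x r = {y \<in> X. d x y < r}"

definition qtopology :: "'a set \<Rightarrow> ('a \<Rightarrow> 'a \<Rightarrow> real) \<Rightarrow> 'a topology" where
  "qtopology X d = topology (\<lambda>U. U \<subseteq> X \<and> (\<forall>x\<in>U. \<exists>r>0. qball X d x r \<subseteq> U))"

lemma istopology_qtopology:
  "istopology (\<lambda>U. U \<subseteq> X \<and> (\<forall>x\<in>U. \<exists>r>0. qball X d x r \<subseteq> U))"
  unfolding istopology_def
proof (intro conjI allI impI)
  fix S T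
  assume S: "S \<subseteq> X \<and> (\<forall>x\<in>S. \<exists>r>0. qball X d x r \<subseteq> S)"
    and T: "T \<subseteq> X \<and> (\<forall>x\<in>T. \<exists>r>0. qball X d x r \<subseteq> T)"
  show "S \<inter> T \<subseteq> X" using S by blast
  show "\<forall>x\<in>S \<inter> T. \<exists>r>0. qball X d x r \<subseteq> S \<inter> T"
  proof
    fix x assume "x \<in> S \<inter> T"
    then obtain r s where "r > 0" "qball X d x r \<subseteq> S" "s > 0" "qball X d x s \<subseteq> T"
      using S T by blast
    then have "min r s > 0 \<and> qball X d x (min r s) \<subseteq> S \<inter> T"
      by (auto simp: qball_def)
    then show "\<exists>r>0. qball X d x r \<subseteq> S \<inter> T" by blast
  qed
next
  fix K
  assume "\<forall>U\<in>K. U \<subseteq> X \<and> (\<forall>x\<in>U. \<exists>r>0. qball X d x r \<subseteq> U)"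
  then show "\<Union>K \<subseteq> X" and "\<forall>x\<in>\<Union>K. \<exists>r>0. qball X d x r \<subseteq> \<Union>K"
    by (blast, meson Union_iff Union_upper subset_trans)
qed

lemma openin_qtopology:
  "openin (qtopology X d) U \<longleftrightarrow> U \<subseteq> X \<and> (\<forall>x\<in>U. \<exists>r>0. qball X d x r \<subseteq> U)"
  by (simp add: qtopology_def topology_inverse'[OF istopology_qtopology])

locale quasi_metric =
  fixes X :: "'a set" and d :: "'a \<Rightarrow> 'a \<Rightarrow> real" and \<kappa> :: real
  assumes nonneg: "x \<in> X \<Longrightarrow> y \<in> X \<Longrightarrow> 0 \<le> d x y"
    and zero_iff: "x \<in> X \<Longrightarrow> y \<in> X \<Longrightarrow> d x y = 0 \<longleftrightarrow> x = y"
    and commute: "x \<in> X \<Longrightarrow> y \<in> X \<Longrightarrow> d x y = d y x"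
    and kappa_ge_1: "1 \<le> \<kappa>"
    and quasi_triangle:
      "x \<in> X \<Longrightarrow> y \<in> X \<Longrightarrow> z \<in> X \<Longrightarrow> d x y \<le> \<kappa> * (d x z + d z y)"

locale homogeneous_type = quasi_metric "space M" d \<kappa>
  for M :: "'a measure" and d :: "'a \<Rightarrow> 'a \<Rightarrow> real" and \<kappa> :: real +
  fixes C :: real
  assumes borel: "sets M = sigma_sets (space M) {U. openin (qtopology (space M) d) U}"
    and doubling:
      "x \<in> space M \<Longrightarrow> 0 < r \<Longrightarrow>
        0 < emeasure M (qball (space M) d x (2 * r)) \<and>
        emeasure M (qball (space M) d x (2 * r)) \<le> ennreal C * emeasure M (qball (space M) d x r) \<and>
        ennreal C * emeasure M (qball (space M) d x r) < \<infinity>"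
    and balls_open:
      "x \<in> space M \<Longrightarrow> 0 < r \<Longrightarrow> openin (qtopology (space M) d) (qball (space M) d x r)"
    and separable: "separable_space (qtopology (space M) d)"
    and infinite_measure: "emeasure M (space M) = \<infinity>"
    and annuli_nonempty:
      "x \<in> space M \<Longrightarrow> 0 < r \<Longrightarrow> r < R \<Longrightarrow>
        qball (space M) d x R - qball (space M) d x r \<noteq> {}"

text \<open>Powers of extended non-negative reals, intended for exponents \<open>a > 0\<close> only.\<close>

definition epowr :: "ennreal \<Rightarrow> real \<Rightarrow> ennreal" where
  "epowr x a = (if x = \<infinity> then \<infinity> else ennreal (enn2real x powr a))"

definition Lq_norm :: "'a measure \<Rightarrow> ennreal \<Rightarrow> ('a \<Rightarrow> complex) \<Rightarrow> ennreal" where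
  "Lq_norm N q f =
    (if q = \<infinity> then esssup N (\<lambda>x. ennreal (cmod (f x)))
     else epowr (\<integral>\<^sup>+x. ennreal (cmod (f x) powr enn2real q) \<partial>N) (1 / enn2real q))"

text \<open>
  The norm \<open>\<^sub>r\<parallel>f\<parallel>\<^sub>q\<^sub>,\<^sub>p\<^sub>,\<^sub>\<alpha>\<close>.  Integration is with respect to the completion of \<open>M\<close>, since \<open>f\<close> is
  only assumed \<open>\<mu>\<close>-measurable.  The exponent \<open>1/\<alpha> - 1/p - 1/q\<close> may be negative, so it is a
  real number; note that \<open>enn2real (1 / \<infinity>) = 0\<close>.
\<close>

definition amalgam_norm ::
  "'a measure \<Rightarrow> ('a \<Rightarrow> 'a \<Rightarrow> real) \<Rightarrow> real \<Rightarrow> ennreal \<Rightarrow> ennreal \<Rightarrow> ennreal \<Rightarrow> ('a \<Rightarrow> complex) \<Rightarrow> ennreal"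
  where
  "amalgam_norm M d r q p \<alpha> f =
    (let B = (\<lambda>y. qball (space M) d y r);
         local_norm = (\<lambda>y. Lq_norm (completion M) q (\<lambda>x. f x * indicator (B y) x))
     in if p = \<infinity>
        then (SUP y\<in>space M.
          ennreal (measure M (B y) powr (enn2real (1 / \<alpha>) - enn2real (1 / q))) * local_norm y)
        else epowr
          (\<integral>\<^sup>+y. epowr
              (ennreal (measure M (B y) powr
                 (enn2real (1 / \<alpha>) - enn2real (1 / p) - enn2real (1 / q))) * local_norm y)
              (enn2real p) \<partial>completion M)
          (1 / enn2real p))"

end

theory Submission
  imports Defs
begin

text \<open>
  If \<open>f\<close> vanishes almost everywhere, then every local norm \<open>\<parallel>f \<chi>\<^bsub>B(y,r)\<^esub>\<parallel>\<^sub>q\<close> is zero and so is the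
  amalgam norm. The converse rests on two observations about the radius \<open>s = r / (2\<kappa>)\<close>.

  By separability countably many balls of radius \<open>s\<close> cover the space. So if \<open>f\<close> is not almost
  everywhere zero, then it is not almost everywhere zero on some ball \<open>B(z,s)\<close>
  (\<open>ex_ball_not_AE_zero\<close>).

  The quasi-triangle inequality gives \<open>B(z,s) \<subseteq> B(y,r) \<subseteq> B(z,\<kappa>(s+r))\<close> for every \<open>y \<in> B(z,s)\<close>.
  The first inclusion bounds the local norm at \<open>y\<close> below by \<open>\<parallel>f \<chi>\<^bsub>B(z,s)\<^esub>\<parallel>\<^sub>q > 0\<close>. The second one
  bounds the weight \<open>\<mu>(B(y,r))\<^bsup>1/\<alpha>-1/p-1/q\<^esup>\<close> below by a positive constant, because \<open>q \<le> \<alpha>\<close> makes the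
  exponent nonpositive and balls have finite measure. So the integrand defining the norm is bounded
  below by a positive constant on \<open>B(z,s)\<close>, a set of positive measure, and the norm is
  positive. The shorter argument that an integrand with integral zero vanishes almost everywhere
  would first require a proof that \<open>y \<mapsto> \<parallel>f \<chi>\<^bsub>B(y,r)\<^esub>\<parallel>\<^sub>q\<close> is measurable; the constant minorant
  avoids this. For \<open>p = \<infinity>\<close> the single centre \<open>y = z\<close> is enough.
\<close>

section \<open>Powers and Lebesgue norms\<close>

lemma enn2real_one_divide_antimono:
  assumes "0 < x" "x \<le> y"
  shows "enn2real (1 / y) \<le> enn2real (1 / x)"
proof (cases y)
  case (real b)
  then obtain a where "x = ennreal a" "0 < a" "a \<le> b"
    using assms by (cases x) (auto simp: top_unique)
  with real show ?thesis
    by (simp add: divide_ennreal frac_le flip: ennreal_1)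
next
  case top
  then show ?thesis by simp
qed

lemma epowr_eq_0_iff: "epowr x a = 0 \<longleftrightarrow> x = 0"
  by (cases x) (auto simp: epowr_def ennreal_eq_0_iff top_unique)

lemma epowr_mono:
  assumes "x \<le> y" "0 \<le> a"
  shows "epowr x a \<le> epowr y a"
  using assms
  by (cases x; cases y) (auto simp: epowr_def top_unique intro!: ennreal_leI powr_mono2)

lemma Lq_norm_eq_0_iff:
  assumes f: "f \<in> borel_measurable N"
  shows "Lq_norm N q f = 0 \<longleftrightarrow> (AE x in N. f x = 0)"
proof (cases "q = \<infinity>")
  case True
  have "AE x in N. f x = 0" if "esssup N (\<lambda>x. ennreal (cmod (f x))) = 0"
    using esssup_AE[of "\<lambda>x. ennreal (cmod (f x))" N] that by (auto simp: ennreal_eq_0_iff)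
  moreover have "esssup N (\<lambda>x. ennreal (cmod (f x))) = 0" if "AE x in N. f x = 0"
  proof -
    have "esssup N (\<lambda>x. ennreal (cmod (f x))) \<le> 0"
      using that f by (intro esssup_I) auto
    then show ?thesis by simp
  qed
  ultimately show ?thesis
    using True by (auto simp: Lq_norm_def)
next
  case False
  have "Lq_norm N q f = 0 \<longleftrightarrow> (AE x in N. ennreal (cmod (f x) powr enn2real q) = 0)"
    using False f by (simp add: Lq_norm_def epowr_eq_0_iff nn_integral_0_iff_AE)
  then show ?thesis
    by (simp add: ennreal_eq_0_iff)
qed

lemma Lq_norm_mono:
  assumes "\<And>x. cmod (f x) \<le> cmod (g x)" and "q \<noteq> \<infinity>"
  shows "Lq_norm N q f \<le> Lq_norm N q g"
  using assms by (auto simp: Lq_norm_def intro!: epowr_mono nn_integral_mono ennreal_leI powr_mono2)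

section \<open>Balls\<close>

context quasi_metric
begin

lemma qball_subset_qball:
  assumes "y \<in> X" "z \<in> X" "d z y < s" "\<kappa> * (s + t) \<le> r"
  shows "qball X d z t \<subseteq> qball X d y r"
proof
  fix x assume x: "x \<in> qball X d z t"
  then have "d y x \<le> \<kappa> * (d z y + d z x)"
    using assms quasi_triangle[of y x z] commute[of y z] by (auto simp: qball_def)
  also have "\<dots> < \<kappa> * (s + t)"
    using assms x kappa_ge_1 by (intro mult_strict_left_mono) (auto simp: qball_def)
  finally show "x \<in> qball X d y r"
    using x assms by (auto simp: qball_def)
qed

lemma centre_in_qball: "x \<in> X \<Longrightarrow> 0 < r \<Longrightarrow> x \<in> qball X d x r"
  using zero_iff[of x x] by (simp add: qball_def)

end

context homogeneous_type
begin

abbreviation B :: "'a \<Rightarrow> real \<Rightarrow> 'a set" where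
  "B \<equiv> qball (space M) d"

lemma sets_qball: "x \<in> space M \<Longrightarrow> 0 < r \<Longrightarrow> B x r \<in> sets M"
  using balls_open by (auto simp: borel)

lemma emeasure_qball_pos: "x \<in> space M \<Longrightarrow> 0 < r \<Longrightarrow> 0 < emeasure M (B x r)"
  using doubling[of x "r / 2"] by simp

lemma emeasure_qball_finite:
  assumes "x \<in> space M" "0 < r"
  shows "emeasure M (B x r) < \<infinity>"
  using doubling[of x "r / 2"] assms by auto

lemma measure_qball_pos: "x \<in> space M \<Longrightarrow> 0 < r \<Longrightarrow> 0 < measure M (B x r)"
  using emeasure_qball_pos[of x r] emeasure_qball_finite[of x r]
  by (simp add: measure_def enn2real_positive_iff)

lemma measure_qball_mono:
  assumes "B y r \<subseteq> B z t" "y \<in> space M" "z \<in> space M" "0 < r" "0 < t"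
  shows "measure M (B y r) \<le> measure M (B z t)"
  using assms emeasure_qball_finite[of z t]
  by (intro measure_mono_fmeasurable) (auto intro!: sets_qball simp: fmeasurable_def)

text \<open>
  Balls are open, so a countable dense set meets \<open>B x s\<close> for every \<open>x\<close>. By symmetry of \<open>d\<close>, the
  balls of radius \<open>s\<close> about its points then cover the space.
\<close>

lemma ex_countable_cover_qball:
  assumes "0 < s"
  obtains D where "countable D" "D \<subseteq> space M" "space M = (\<Union>z\<in>D. B z s)"
proof -
  have top: "topspace (qtopology (space M) d) = space M"
  proof
    show "topspace (qtopology (space M) d) \<subseteq> space M"
      by (meson openin_qtopology openin_topspace)
    show "space M \<subseteq> topspace (qtopology (space M) d)"
      by (rule openin_subset) (auto simp: openin_qtopology qball_def intro!: exI[of _ 1])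
  qed
  obtain D where D: "countable D" "D \<subseteq> space M"
    and dense: "qtopology (space M) d closure_of D = space M"
    using separable by (auto simp: separable_space_def top)
  have "\<exists>z\<in>D. x \<in> B z s" if x: "x \<in> space M" for x
  proof -
    have "x \<in> qtopology (space M) d closure_of D"
      using dense x by simp
    then obtain z where "z \<in> D" "z \<in> B x s"
      using balls_open[OF x assms] centre_in_qball[OF x assms]
      unfolding in_closure_of by blast
    then show ?thesis
      using x D commute[of x z] by (auto simp: qball_def intro!: bexI[of _ z])
  qed
  then have "space M = (\<Union>z\<in>D. B z s)"
    by (auto simp: qball_def)
  with D that show thesis by blast
qed

text \<open>
  The countable cover reduces the question to single balls, since a countable union of null sets
  is null.
\<close>

lemma ex_ball_not_AE_zero:
  fixes f :: "'a \<Rightarrow> complex"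
  assumes "0 < s" and "\<not> (AE x in M. f x = 0)"
  obtains z where "z \<in> space M" "\<not> (AE x in M. f x * indicator (B z s) x = 0)"
proof -
  obtain D where D: "countable D" "D \<subseteq> space M" "space M = (\<Union>z\<in>D. B z s)"
    using ex_countable_cover_qball[OF assms(1)] .
  have "AE x in M. f x = 0" if "\<And>z. z \<in> D \<Longrightarrow> AE x in M. f x * indicator (B z s) x = 0"
  proof -
    have "AE x in M. \<forall>z\<in>D. f x * indicator (B z s) x = 0"
      using that by (subst AE_ball_countable[OF D(1)]) blast
    then show ?thesis
    proof (rule AE_mp, intro AE_I2 impI)
      fix x assume "x \<in> space M" and *: "\<forall>z\<in>D. f x * indicator (B z s) x = 0"
      then obtain z where "z \<in> D" "x \<in> B z s"
        using D(3) by blast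
      then show "f x = 0"
        using * by force
    qed
  qed
  with assms(2) D(2) that show thesis by blast
qed

section \<open>Local norms and the amalgam norm\<close>

abbreviation local_norm :: "ennreal \<Rightarrow> ('a \<Rightarrow> complex) \<Rightarrow> 'a \<Rightarrow> real \<Rightarrow> ennreal" where
  "local_norm q f y r \<equiv> Lq_norm (completion M) q (\<lambda>x. f x * indicator (B y r) x)"

lemma local_norm_eq_0_iff:
  assumes "f \<in> borel_measurable (completion M)" "y \<in> space M" "0 < r"
  shows "local_norm q f y r = 0 \<longleftrightarrow> (AE x in M. f x * indicator (B y r) x = 0)"
proof -
  have "B y r \<in> sets (completion M)"
    using assms by (intro sets_completionI_sets sets_qball)
  then have "(\<lambda>x. f x * indicator (B y r) x) \<in> borel_measurable (completion M)"
    using assms(1) by (intro borel_measurable_times borel_measurable_indicator)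
  then show ?thesis
    by (simp add: Lq_norm_eq_0_iff AE_completion_iff)
qed

lemma local_norm_mono:
  assumes "B z s \<subseteq> B y r" "q \<noteq> \<infinity>"
  shows "local_norm q f z s \<le> local_norm q f y r"
  using assms by (intro Lq_norm_mono) (auto simp: indicator_def)

lemma amalgam_norm_eq_0_if_AE_zero:
  assumes "f \<in> borel_measurable (completion M)" "0 < r" "AE x in M. f x = 0"
  shows "amalgam_norm M d r q p \<alpha> f = 0"
proof -
  have zero: "local_norm q f y r = 0" if "y \<in> space M" for y
    using assms that by (subst local_norm_eq_0_iff) auto
  have "(\<integral>\<^sup>+y. epowr
      (ennreal (measure M (B y r) powr (enn2real (1 / \<alpha>) - enn2real (1 / p) - enn2real (1 / q)))
        * local_norm q f y r) (enn2real p) \<partial>completion M) = (\<integral>\<^sup>+y. 0 \<partial>completion M)"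
    by (intro nn_integral_cong) (simp add: zero epowr_eq_0_iff)
  moreover have "(SUP y\<in>space M. ennreal (measure M (B y r) powr
      (enn2real (1 / \<alpha>) - enn2real (1 / q))) * local_norm q f y r) \<le> 0"
    by (rule SUP_least) (simp add: zero)
  ultimately show ?thesis
    by (simp add: amalgam_norm_def epowr_eq_0_iff)
qed

text \<open>
  A ball \<open>B(z,s)\<close> on which \<open>f\<close> is not almost everywhere zero lies inside \<open>B(y,r)\<close> for all \<open>y\<close> near
  \<open>z\<close>, so it contributes a fixed positive amount to the integrand at each such \<open>y\<close>.
\<close>

lemma AE_zero_if_amalgam_norm_eq_0:
  assumes f: "f \<in> borel_measurable (completion M)" and r: "0 < r"
    and q: "0 < q" "q \<le> \<alpha>" "\<alpha> \<le> p"
    and norm: "amalgam_norm M d r q p \<alpha> f = 0"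
  shows "AE x in M. f x = 0"
proof (rule ccontr)
  assume nz: "\<not> (AE x in M. f x = 0)"
  \<comment> \<open>Any two points of a ball of radius \<open>s\<close> are then at distance less than \<open>r\<close>.\<close>
  define s where "s = r / (2 * \<kappa>)"
  have s: "0 < s" "\<kappa> * (s + s) \<le> r"
    using r kappa_ge_1 by (auto simp: s_def field_simps)
  obtain z where z: "z \<in> space M" "\<not> (AE x in M. f x * indicator (B z s) x = 0)"
    using ex_ball_not_AE_zero[OF s(1) nz] .
  then have c: "local_norm q f z s \<noteq> 0"
    using f s by (simp add: local_norm_eq_0_iff)
  have inner: "B z s \<subseteq> B y r" if "y \<in> B z s" for y
    using that z s by (intro qball_subset_qball[where s = s]) (auto simp: qball_def)
  show False
  proof (cases "p = \<infinity>")
    case True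
    have "ennreal (measure M (B z r) powr (enn2real (1 / \<alpha>) - enn2real (1 / q)))
        * local_norm q f z r = 0"
    proof -
      have "\<forall>y\<in>space M. ennreal (measure M (B y r) powr (enn2real (1 / \<alpha>) - enn2real (1 / q)))
        * local_norm q f y r \<le> 0"
        using norm True by (simp add: amalgam_norm_def SUP_le_iff flip: le_zero_eq)
      with z show ?thesis by auto
    qed
    then have "local_norm q f z r = 0"
      using measure_qball_pos[OF z(1) r] by (simp add: ennreal_eq_0_iff)
    then have "AE x in M. f x * indicator (B z r) x = 0"
      using f z r by (simp add: local_norm_eq_0_iff)
    then have "AE x in M. f x * indicator (B z s) x = 0"
      by (rule AE_mp) (use inner[OF centre_in_qball[OF z(1) s(1)]] in \<open>auto simp: indicator_def\<close>)
    with z show False by simp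
  next
    case False
    then have q_fin: "q \<noteq> \<infinity>"
      using q by (auto simp: top_unique)
    define e where "e = enn2real (1 / \<alpha>) - enn2real (1 / p) - enn2real (1 / q)"
    have "enn2real (1 / \<alpha>) \<le> enn2real (1 / q)"
      using q by (intro enn2real_one_divide_antimono)
    then have e: "e \<le> 0"
      unfolding e_def using enn2real_nonneg[of "1 / p"] by linarith
    define t where "t = \<kappa> * (s + r)"
    have t: "0 < t"
      using s r kappa_ge_1 by (simp add: t_def)
    have outer: "B y r \<subseteq> B z t" if "y \<in> B z s" for y
      using that z by (intro qball_subset_qball[where s = s]) (auto simp: qball_def t_def commute)
    define w where
      "w = epowr (ennreal (measure M (B z t) powr e) * local_norm q f z s) (enn2real p)"
    have w: "w \<noteq> 0"
      using c measure_qball_pos[OF z(1) t] by (simp add: w_def epowr_eq_0_iff ennreal_eq_0_iff)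
    have below: "w \<le> epowr (ennreal (measure M (B y r) powr e) * local_norm q f y r) (enn2real p)"
      if y: "y \<in> B z s" for y
    proof -
      have ys: "y \<in> space M"
        using y by (simp add: qball_def)
      have "measure M (B z t) powr e \<le> measure M (B y r) powr e"
        using measure_qball_mono[OF outer[OF y]] measure_qball_pos[OF ys r] ys z r t e
        by (intro powr_mono2') auto
      then show ?thesis
        unfolding w_def
        by (intro epowr_mono mult_mono local_norm_mono[OF inner[OF y] q_fin] ennreal_leI) auto
    qed
    have "w * emeasure M (B z s) = (\<integral>\<^sup>+y. w * indicator (B z s) y \<partial>completion M)"
      using sets_qball[OF z(1) s(1)] by (simp add: nn_integral_cmult_indicator)
    also have "\<dots> \<le> (\<integral>\<^sup>+y. epowr (ennreal (measure M (B y r) powr e) * local_norm q f y r)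
        (enn2real p) \<partial>completion M)"
      using below by (intro nn_integral_mono) (auto simp: indicator_def)
    also have "\<dots> = 0"
      using norm False by (simp add: amalgam_norm_def e_def epowr_eq_0_iff)
    finally show False
      using w emeasure_qball_pos[OF z(1) s(1)] by auto
  qed
qed

end

theorem theorem2p2:
  fixes M :: "'a measure" and d :: "'a \<Rightarrow> 'a \<Rightarrow> real" and \<kappa> C r :: real
    and q \<alpha> p :: ennreal and f :: "'a \<Rightarrow> complex"
  assumes "homogeneous_type M d \<kappa> C"
    and "1 \<le> q" and "q \<le> \<alpha>" and "\<alpha> \<le> p"
    and "f \<in> borel_measurable (completion M)"
    and "0 < r"
  shows "amalgam_norm M d r q p \<alpha> f = 0 \<longleftrightarrow> (AE x in M. f x = 0)"
proof -
  interpret homogeneous_type M d \<kappa> C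
    by fact
  have "0 < q"
    using \<open>1 \<le> q\<close> by (rule less_le_trans[OF zero_less_one])
  with assms show ?thesis
    using AE_zero_if_amalgam_norm_eq_0 amalgam_norm_eq_0_if_AE_zero by blast
qed

end
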